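(* Let $\mathbf{A}=[\mathbf{a}_1\ \cdots\ \mathbf{a}_m]\in\mathbb{R}^{n\times m}$ with $m\ge n$ be such that (i) no column of $\mathbf{A}$ is the zero vector and (ii) no two (distinct-index) columns of $\mathbf{A}$ are scalar multiples of each other. Let $Z=Z(\mathbf{A})=\{\mathbf{A}\mathbf{x}\mid \mathbf{x}\in[-1,1]^m\}$, let $H=\bigcup_{i=1}^m\{\mathbf{x}\in\mathbb{R}^n\mid\langle\mathbf{a}_i,\mathbf{x}\rangle=0\}$, and let $\mathbf{m}(\mathbf{x})=\mathbf{A}\,\operatorname{sign}(\mathbf{A}^T\mathbf{x})$ for $\mathbf{x}\in\mathbb{R}^n\setminus H$. Then for every vertex $\mathbf{v}$ of $Z$, $$\mathbf{m}^{-1}(\mathbf{v})=\operatorname{int}(N_Z(\mathbf{v})),$$ where $\mathbf{m}^{-1}(\mathbf{v})=\{\mathbf{x}\in\mathbb{R}^n\setminus H\mid \mathbf{m}(\mathbf{x})=\mathbf{v}\}$.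
   Context: For a vector $\mathbf{w}$ with all entries nonzero, $\operatorname{sign}(\mathbf{w})$ is the vector with entries in $\{-1,1\}$ giving the signs of the components of $\mathbf{w}$. The normal cone of $Z$ at $\mathbf{v}$ is $N_Z(\mathbf{v})=\{\mathbf{x}\in\mathbb{R}^n\mid\langle\mathbf{x},\mathbf{z}-\mathbf{v}\rangle\le 0\text{ for all }\mathbf{z}\in Z\}$. $\operatorname{int}$ denotes the interior in $\mathbb{R}^n$. A vertex of a polytope is an extreme point of it. *)

theory Defs
  imports "HOL-Analysis.Analysis"
begin

text \<open>A matrix with n rows and m columns has type \<open>real ^ 'm ^ 'n\<close>; its i-th column is
  \<open>column i A\<close>, a vector of type \<open>real ^ 'n\<close>.\<close>

definition zonotope :: "real ^ 'm ^ 'n \<Rightarrow> (real ^ 'n) set" where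
  "zonotope A = {A *v x | x. \<forall>i. x $ i \<in> {-1..1}}"

definition hyperplane_union :: "real ^ 'm ^ 'n \<Rightarrow> (real ^ 'n) set" where
  "hyperplane_union A = (\<Union>i. {x. column i A \<bullet> x = 0})"

text \<open>The sign vector is only meant for vectors without zero entries, where every entry of the
  result is -1 or 1; elsewhere \<open>sgn 0 = 0\<close> is a dummy value.\<close>

definition sign_vec :: "real ^ 'm \<Rightarrow> real ^ 'm" where
  "sign_vec w = (\<chi> i. sgn (w $ i))"

text \<open>Only meaningful outside \<open>hyperplane_union A\<close>; the intended domain is imposed
  explicitly in \<open>vertex_map_fibre\<close>.\<close>

definition vertex_map :: "real ^ 'm ^ 'n \<Rightarrow> real ^ 'n \<Rightarrow> real ^ 'n" where
  "vertex_map A x = A *v sign_vec (transpose A *v x)"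

definition vertex_map_fibre :: "real ^ 'm ^ 'n \<Rightarrow> real ^ 'n \<Rightarrow> (real ^ 'n) set" where
  "vertex_map_fibre A v = {x. x \<notin> hyperplane_union A \<and> vertex_map A x = v}"

definition normal_cone :: "(real ^ 'n) set \<Rightarrow> real ^ 'n \<Rightarrow> (real ^ 'n) set" where
  "normal_cone Z v = {x. \<forall>z\<in>Z. x \<bullet> (z - v) \<le> 0}"

end

theory Submission
  imports Defs
begin

text \<open>
  Write a point of the zonotope as \<open>A *v y\<close> with \<open>y\<close> in the cube. The linear functional
  \<open>x \<bullet> _\<close> takes there the value \<open>\<Sum>j. y $ j * (column j A \<bullet> x)\<close>, whose maximum over the cube is
  attained coordinate by coordinate. Hence \<open>x\<close> lies in the normal cone at \<open>A *v y\<close> if and only if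
  \<open>y $ j * (column j A \<bullet> x) = \<bar>column j A \<bullet> x\<bar>\<close> for every \<open>j\<close>
  (\<open>normal_cone_zonotope_iff\<close>): each \<open>y $ j\<close> is the sign of \<open>column j A \<bullet> x\<close> wherever that inner
  product does not vanish. Both inclusions follow from this criterion.

  The sign vector of \<open>x\<close> satisfies it, so a fibre of the vertex map lies in the normal cone. The
  signs do not change near a point off the hyperplanes, so the fibre is open and therefore lies in
  the interior of the cone.

  Conversely, let \<open>x\<close> be interior to the normal cone at \<open>v = A *v y\<close>. If \<open>x\<close> were on the hyperplane
  orthogonal to \<open>column i A\<close>, then moving \<open>x\<close> slightly in the directions \<open>column i A\<close> and
  \<open>- column i A\<close> would stay in the cone, and the criterion would force both \<open>y $ i = 1\<close> and
  \<open>y $ i = - 1\<close>. So \<open>x\<close> avoids all hyperplanes, the criterion determines \<open>y\<close> as the sign vector, and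
  \<open>v\<close> is the image of \<open>x\<close>.
\<close>

lemma transpose_mult_nth:
  fixes A :: "real ^ 'm ^ 'n"
  shows "(transpose A *v x) $ j = column j A \<bullet> x"
  by (simp add: matrix_vector_mult_def transpose_def column_def inner_vec_def)

lemma inner_matrix_mult_columns:
  fixes A :: "real ^ 'm ^ 'n"
  shows "x \<bullet> (A *v y) = (\<Sum>j\<in>UNIV. y $ j * (column j A \<bullet> x))"
  by (simp add: matrix_mult_sum inner_sum_right scalar_mult_eq_scaleR inner_commute)

lemma sign_vec_in_cube: "sign_vec w $ i \<in> {-1..1}"
  by (simp add: sign_vec_def sgn_if)

lemma mult_le_abs_of_cube:
  fixes s t :: real
  assumes "s \<in> {-1..1}"
  shows "s * t \<le> \<bar>t\<bar>"
proof -
  have "s * t \<le> \<bar>s\<bar> * \<bar>t\<bar>"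
    by (metis abs_ge_self abs_mult)
  also have "\<dots> \<le> 1 * \<bar>t\<bar>"
    using assms by (intro mult_right_mono) auto
  finally show ?thesis by simp
qed

text \<open>The support function of the zonotope at \<open>x\<close> is \<open>\<Sum>j. \<bar>column j A \<bullet> x\<bar>\<close>, attained at the image of
  the sign vector of \<open>x\<close>. A point \<open>A *v y\<close> attains it exactly when every summand is as large as
  possible, because no summand can make up for a deficit in another.\<close>

lemma normal_cone_zonotope_iff:
  fixes A :: "real ^ 'm ^ 'n"
  assumes y: "\<And>i. y $ i \<in> {-1..1}"
  shows "x \<in> normal_cone (zonotope A) (A *v y) \<longleftrightarrow>
    (\<forall>j. y $ j * (column j A \<bullet> x) = \<bar>column j A \<bullet> x\<bar>)"
proof
  assume cone: "x \<in> normal_cone (zonotope A) (A *v y)"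
  have "A *v sign_vec (transpose A *v x) \<in> zonotope A"
    unfolding zonotope_def using sign_vec_in_cube by blast
  with cone have "x \<bullet> (A *v sign_vec (transpose A *v x)) \<le> x \<bullet> (A *v y)"
    by (auto simp: normal_cone_def inner_diff_right)
  then have "(\<Sum>j\<in>UNIV. \<bar>column j A \<bullet> x\<bar>) \<le> (\<Sum>j\<in>UNIV. y $ j * (column j A \<bullet> x))"
    by (simp add: inner_matrix_mult_columns sign_vec_def transpose_mult_nth abs_sgn mult.commute
        del: transpose_matrix_vector)
  then have "(\<Sum>j\<in>UNIV. \<bar>column j A \<bullet> x\<bar> - y $ j * (column j A \<bullet> x)) \<le> 0"
    by (simp add: sum_subtractf)
  moreover have nonneg: "0 \<le> \<bar>column j A \<bullet> x\<bar> - y $ j * (column j A \<bullet> x)" for j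
    using mult_le_abs_of_cube[OF y] by simp
  ultimately have "(\<Sum>j\<in>UNIV. \<bar>column j A \<bullet> x\<bar> - y $ j * (column j A \<bullet> x)) = 0"
    by (meson antisym sum_nonneg)
  with nonneg show "\<forall>j. y $ j * (column j A \<bullet> x) = \<bar>column j A \<bullet> x\<bar>"
    by (simp add: sum_nonneg_eq_0_iff)
next
  assume eq: "\<forall>j. y $ j * (column j A \<bullet> x) = \<bar>column j A \<bullet> x\<bar>"
  have "x \<bullet> (A *v z) \<le> x \<bullet> (A *v y)" if "\<forall>i. z $ i \<in> {-1..1}" for z
    unfolding inner_matrix_mult_columns
    using that eq mult_le_abs_of_cube by (intro sum_mono) metis
  then show "x \<in> normal_cone (zonotope A) (A *v y)"
    unfolding normal_cone_def zonotope_def by (auto simp: inner_diff_right)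
qed

lemma vertex_map_fibre_subset_normal_cone:
  "vertex_map_fibre A v \<subseteq> normal_cone (zonotope A) v"
proof
  fix x assume "x \<in> vertex_map_fibre A v"
  then have v: "v = A *v sign_vec (transpose A *v x)"
    by (simp add: vertex_map_fibre_def vertex_map_def)
  show "x \<in> normal_cone (zonotope A) v"
    unfolding v
    by (subst normal_cone_zonotope_iff[OF sign_vec_in_cube])
       (simp add: sign_vec_def transpose_mult_nth abs_sgn mult.commute
         del: transpose_matrix_vector)
qed

text \<open>Off the hyperplanes, keeping all the signs amounts to finitely many strict linear
  inequalities, so the set of points with the same sign vector as \<open>x\<close> is an open neighbourhood of
  \<open>x\<close>.\<close>

lemma open_vertex_map_fibre: "open (vertex_map_fibre A v)"
proof (subst open_subopen, intro ballI)
  fix x assume x: "x \<in> vertex_map_fibre A v"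
  define U where "U = (\<Inter>i. {u. 0 < (column i A \<bullet> x) * (column i A \<bullet> u)})"
  have nz: "column i A \<bullet> x \<noteq> 0" for i
    using x by (auto simp: vertex_map_fibre_def hyperplane_union_def)
  have "open U"
    unfolding U_def
    by (intro open_INT ballI finite_class.finite_UNIV open_Collect_less continuous_intros)
  moreover have "x \<in> U"
    using nz by (auto simp: U_def zero_less_mult_iff neq_iff)
  moreover have "U \<subseteq> vertex_map_fibre A v"
  proof
    fix u assume u: "u \<in> U"
    then have "column i A \<bullet> u \<noteq> 0 \<and> sgn (column i A \<bullet> u) = sgn (column i A \<bullet> x)" for i
      by (auto simp: U_def zero_less_mult_iff dest!: spec[of _ i])
    then have "u \<notin> hyperplane_union A" "vertex_map A u = vertex_map A x"
      by (auto simp: hyperplane_union_def vertex_map_def sign_vec_def transpose_mult_nth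
          simp del: transpose_matrix_vector)
    with x show "u \<in> vertex_map_fibre A v"
      by (simp add: vertex_map_fibre_def)
  qed
  ultimately show "\<exists>T. open T \<and> x \<in> T \<and> T \<subseteq> vertex_map_fibre A v"
    by blast
qed

text \<open>On the hyperplane orthogonal to \<open>column i A\<close>, the functional does not see the \<open>i\<close>-th coordinate
  of a maximiser \<open>y\<close>, but arbitrarily small tilts to the two sides demand opposite values of it.
  So a neighbourhood of such a point cannot lie in a single normal cone.\<close>

lemma interior_normal_cone_avoids_hyperplanes:
  fixes A :: "real ^ 'm ^ 'n"
  assumes nz: "\<And>i. column i A \<noteq> 0"
    and y: "\<And>i. y $ i \<in> {-1..1}"
    and x: "x \<in> interior (normal_cone (zonotope A) (A *v y))"
  shows "x \<notin> hyperplane_union A"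
proof
  assume "x \<in> hyperplane_union A"
  then obtain i where i: "column i A \<bullet> x = 0"
    by (auto simp: hyperplane_union_def)
  obtain e where e: "e > 0" "ball x e \<subseteq> normal_cone (zonotope A) (A *v y)"
    using x by (auto simp: mem_interior)
  define t where "t = e / (2 * norm (column i A))"
  have t: "t > 0" "t * norm (column i A) < e"
    using e(1) nz by (simp_all add: t_def)
  have pos: "column i A \<bullet> column i A > 0"
    using nz by simp
  have tilt: "y $ i * (s * (column i A \<bullet> column i A)) = \<bar>s * (column i A \<bullet> column i A)\<bar>"
    if "\<bar>s\<bar> = t" for s
  proof -
    have "x + s *\<^sub>R column i A \<in> ball x e"
      using that t by (simp add: dist_norm)
    then have "x + s *\<^sub>R column i A \<in> normal_cone (zonotope A) (A *v y)"
      using e(2) by blast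
    then have "y $ i * (column i A \<bullet> (x + s *\<^sub>R column i A)) =
        \<bar>column i A \<bullet> (x + s *\<^sub>R column i A)\<bar>"
      using normal_cone_zonotope_iff[OF y] by blast
    then show ?thesis
      by (simp add: inner_add_right i)
  qed
  have "y $ i = 1"
    using tilt[of t] t pos by (simp add: abs_mult)
  moreover have "(y $ i + 1) * (t * (column i A \<bullet> column i A)) = 0"
    using tilt[of "- t"] t pos by (simp add: abs_mult distrib_right)
  then have "y $ i = - 1"
    using t pos by simp
  ultimately show False by simp
qed

lemma interior_normal_cone_subset_fibre:
  fixes A :: "real ^ 'm ^ 'n"
  assumes nz: "\<And>i. column i A \<noteq> 0" and v: "v \<in> zonotope A"
  shows "interior (normal_cone (zonotope A) v) \<subseteq> vertex_map_fibre A v"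
proof
  fix x assume x: "x \<in> interior (normal_cone (zonotope A) v)"
  from v obtain y where y: "\<And>i. y $ i \<in> {-1..1}" and vy: "v = A *v y"
    unfolding zonotope_def by blast
  have off: "x \<notin> hyperplane_union A"
    using interior_normal_cone_avoids_hyperplanes[OF nz y] x vy by blast
  have "x \<in> normal_cone (zonotope A) (A *v y)"
    using x vy interior_subset by blast
  then have eq: "y $ j * (column j A \<bullet> x) = \<bar>column j A \<bullet> x\<bar>" for j
    using normal_cone_zonotope_iff[OF y] by blast
  have "y $ j = sgn (column j A \<bullet> x)" for j
  proof -
    have "column j A \<bullet> x \<noteq> 0"
      using off by (auto simp: hyperplane_union_def)
    moreover have "y $ j * (column j A \<bullet> x) = sgn (column j A \<bullet> x) * (column j A \<bullet> x)"
      using eq by (simp add: abs_sgn mult.commute)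
    ultimately show ?thesis by simp
  qed
  then have "y = sign_vec (transpose A *v x)"
    by (simp add: vec_eq_iff sign_vec_def transpose_mult_nth del: transpose_matrix_vector)
  with off vy show "x \<in> vertex_map_fibre A v"
    by (simp add: vertex_map_fibre_def vertex_map_def)
qed

theorem theorem3:
  fixes A :: "real ^ 'm ^ 'n" and v :: "real ^ 'n"
  assumes "CARD('n) \<le> CARD('m)"
    and "\<And>i. column i A \<noteq> 0"
    and "\<And>i j c. i \<noteq> j \<Longrightarrow> column i A \<noteq> c *\<^sub>R column j A"
    and "v extreme_point_of zonotope A"
  shows "vertex_map_fibre A v = interior (normal_cone (zonotope A) v)"
proof
  show "vertex_map_fibre A v \<subseteq> interior (normal_cone (zonotope A) v)"
    using vertex_map_fibre_subset_normal_cone open_vertex_map_fibre by (rule interior_maximal)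
  have "v \<in> zonotope A"
    using assms(4) by (simp add: extreme_point_of_def)
  with assms(2) show "interior (normal_cone (zonotope A) v) \<subseteq> vertex_map_fibre A v"
    by (rule interior_normal_cone_subset_fibre)
qed

end
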